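(* Let $\mathcal{H}:\mathbb{R}^{2n}\to\mathbb{R}$ be proper, closed, convex and continuously differentiable. Suppose $\mathcal{H}$ has a unique minimizer $z_\star = \operatorname{argmin}_{z} \mathcal{H}(z)$, and that $\mathcal{H}(z)\ge \mathcal{H}(z_\star)=0$ for all $z\in\mathbb{R}^{2n}$. Let $z_t$, $t\ge 0$, be a solution of $$\dot z_t = J\nabla\mathcal{H}(z_t) + z_\star - z_t, \qquad J=\begin{bmatrix}0 & I\\ -I & 0\end{bmatrix}.$$ Then $\mathcal{H}(z_t)$ converges to zero linearly (i.e., geometrically) as $t\to\infty$. Furthermore, $z_t\to z_\star$ and $\dot z_t\to 0$ as $t\to\infty$.
   Context: $I$ is the $n\times n$ identity matrix, so $J$ is a $2n\times 2n$ matrix, and $\dot z_t = dz_t/dt$. A solution is a differentiable curve $t\mapsto z_t\in\mathbb{R}^{2n}$ defined for all $t\ge 0$ and satisfying the ODE. A nonnegative function $\phi(t)$ converges to zero linearly (geometrically) if there are constants $C\ge 0$ and $c>0$ with $\phi(t)\le C e^{-ct}$ for all $t\ge 0$. *)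

theory Defs
  imports "HOL-Analysis.Analysis"
begin

(* R^(2n) is rendered as real ^ ('n + 'n): the Inl indices are the first n coordinates
   and the Inr indices the last n, so the matrix below is [[0, I], [-I, 0]]. *)
definition symplectic_J :: "real ^ ('n::finite + 'n) ^ ('n + 'n)" where
  "symplectic_J = (\<chi> i j. case (i, j) of
       (Inl a, Inl b) \<Rightarrow> 0
     | (Inl a, Inr b) \<Rightarrow> mat 1 $ a $ b
     | (Inr a, Inl b) \<Rightarrow> - (mat 1 $ a $ b)
     | (Inr a, Inr b) \<Rightarrow> 0)"

definition converges_linearly_to_0 :: "(real \<Rightarrow> real) \<Rightarrow> bool" where
  "converges_linearly_to_0 \<phi> \<longleftrightarrow>
     (\<forall>t\<ge>0. 0 \<le> \<phi> t) \<and> (\<exists>C\<ge>0. \<exists>c>0. \<forall>t\<ge>0. \<phi> t \<le> C * exp (- c * t))"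

end

theory Submission
  imports Defs
begin

text \<open>
  The function \<open>H\<close> is its own Lyapunov function. Along a solution,
  \<open>dH/dt = \<nabla>H \<bullet> J \<nabla>H + \<nabla>H \<bullet> (z\<^sub>\<star> - z)\<close>. The first term is zero because \<open>J\<close> is skew-symmetric
  (\<open>inner_symplectic_J_self\<close>), and convexity bounds the second by \<open>H z\<^sub>\<star> - H z = - H z\<close>
  (\<open>convex_on_gradient_inequality\<close>). Hence \<open>dH/dt \<le> - H\<close>, and Gronwall's inequality
  (\<open>exp_decay_if_deriv_le_neg\<close>) gives \<open>H (z t) \<le> H (z 0) exp (- t)\<close>: the Hamiltonian part of the
  field moves along level sets, and the pull towards \<open>z\<^sub>\<star>\<close> does all the work.

  In finite dimension a convex function with a unique minimizer exceeds its minimum by a fixed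
  amount outside each ball around the minimizer (\<open>convex_on_unique_minimum_gap\<close>), so
  \<open>H (z t) \<longlonglongrightarrow> 0\<close> forces \<open>z t\<close> to approach \<open>z\<^sub>\<star>\<close>. Finally, the right-hand side of the equation is
  continuous in \<open>z\<close> and vanishes at \<open>z\<^sub>\<star>\<close>, where the gradient is zero, so the velocity tends to zero.
\<close>

lemma inner_matrix_vector_self_eq_0:
  fixes A :: "real ^ 'n ^ 'n"
  assumes "transpose A = - A"
  shows "x \<bullet> (A *v x) = 0"
proof -
  have "x \<bullet> (A *v x) = (transpose A *v x) \<bullet> x"
    by (simp add: dot_lmul_matrix)
  also have "\<dots> = - (x \<bullet> (A *v x))"
    unfolding assms
    by (simp add: inner_commute matrix_vector_mult_def inner_vec_def sum_negf)
  finally show ?thesis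
    by simp
qed

lemma transpose_symplectic_J:
  "transpose symplectic_J = - (symplectic_J :: real ^ ('n::finite + 'n) ^ ('n + 'n))"
  by (auto simp: vec_eq_iff transpose_def symplectic_J_def mat_def split: sum.split)

lemma inner_symplectic_J_self: "x \<bullet> (symplectic_J *v x) = 0"
  by (rule inner_matrix_vector_self_eq_0[OF transpose_symplectic_J])

text \<open>Restricted to the line through \<open>x\<close> and \<open>y\<close>, this is the fact that a convex function of one
  real variable lies above its tangents.\<close>

lemma convex_on_gradient_inequality:
  fixes f :: "'a::real_inner \<Rightarrow> real"
  assumes convex: "convex_on UNIV f" and grad: "GDERIV f x :> g"
  shows "g \<bullet> (y - x) \<le> f y - f x"
proof -
  define \<phi> where "\<phi> s = f (x + s *\<^sub>R (y - x))" for s :: real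
  have "convex_on UNIV \<phi>"
  proof (rule convex_onI)
    fix t a b :: real
    assume t: "0 < t" "t < 1"
    have "x + ((1 - t) * a + t * b) *\<^sub>R (y - x)
        = (1 - t) *\<^sub>R (x + a *\<^sub>R (y - x)) + t *\<^sub>R (x + b *\<^sub>R (y - x))"
      by (simp add: algebra_simps)
    then show "\<phi> ((1 - t) *\<^sub>R a + t *\<^sub>R b) \<le> (1 - t) * \<phi> a + t * \<phi> b"
      using convex_onD[OF convex, of t "x + a *\<^sub>R (y - x)" "x + b *\<^sub>R (y - x)"] t
      by (simp add: \<phi>_def)
  qed simp
  moreover have "(\<phi> has_field_derivative g \<bullet> (y - x)) (at 0 within UNIV)"
  proof -
    have "((\<lambda>s. x + s *\<^sub>R (y - x)) has_derivative (\<lambda>s. s *\<^sub>R (y - x))) (at 0)"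
      by (auto intro!: derivative_eq_intros)
    moreover have "(f has_derivative (\<lambda>h. h \<bullet> g)) (at (x + 0 *\<^sub>R (y - x)))"
      using grad by (simp add: gderiv_def)
    ultimately have "(\<phi> has_derivative (\<lambda>s. (s *\<^sub>R (y - x)) \<bullet> g)) (at 0)"
      unfolding \<phi>_def by (rule has_derivative_compose)
    then show ?thesis
      by (simp add: has_field_derivative_def inner_commute mult_commute_abs)
  qed
  ultimately have "\<phi> 1 - \<phi> 0 \<ge> g \<bullet> (y - x) * (1 - 0)"
    by (intro convex_on_imp_above_tangent) auto
  then show ?thesis
    by (simp add: \<phi>_def)
qed

lemma GDERIV_at_minimum_eq_0:
  assumes grad: "GDERIV f x :> g" and min: "\<And>y. f x \<le> f y"
  shows "g = 0"
proof -
  have "(\<lambda>h. h \<bullet> g) = (\<lambda>h. 0)"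
    using grad min unfolding gderiv_def
    by (intro differential_zero_maxmin[where S = UNIV]) auto
  then show ?thesis
    by (metis inner_eq_zero_iff)
qed

text \<open>Gronwall's inequality: the hypothesis says exactly that \<open>\<phi> t * exp t\<close> has nonpositive
  derivative.\<close>

lemma exp_decay_if_deriv_le_neg:
  fixes \<phi> :: "real \<Rightarrow> real"
  assumes deriv: "\<And>t. t \<ge> 0 \<Longrightarrow> (\<phi> has_real_derivative \<phi>' t) (at t within {0..})"
    and le: "\<And>t. t \<ge> 0 \<Longrightarrow> \<phi>' t \<le> - \<phi> t"
    and "t \<ge> 0"
  shows "\<phi> t \<le> \<phi> 0 * exp (- t)"
proof -
  define \<psi> where "\<psi> s = \<phi> s * exp s" for s
  have \<psi>: "(\<psi> has_real_derivative (\<phi>' s + \<phi> s) * exp s) (at s within {0..})" if "s \<ge> 0" for s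
    unfolding \<psi>_def using deriv[OF that]
    by (auto intro!: derivative_eq_intros simp: algebra_simps)
  have "\<psi> t \<le> \<psi> 0"
  proof (rule DERIV_nonpos_imp_decreasing_open[OF \<open>t \<ge> 0\<close>])
    fix s :: real
    assume "0 < s"
    then have "(\<psi> has_real_derivative (\<phi>' s + \<phi> s) * exp s) (at s)"
      using \<psi>[of s] at_within_interior[of s "{0..}"] by (simp add: interior_real_atLeast)
    moreover have "(\<phi>' s + \<phi> s) * exp s \<le> 0"
      using le[of s] \<open>0 < s\<close> by (intro mult_nonpos_nonneg) auto
    ultimately show "\<exists>y. (\<psi> has_real_derivative y) (at s) \<and> y \<le> 0"
      by blast
  next
    have "continuous_on {0..} \<psi>"
      using \<psi> by (intro DERIV_continuous_on) auto
    then show "continuous_on {0..t} \<psi>"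
      by (rule continuous_on_subset) auto
  qed
  then show ?thesis
    by (simp add: \<psi>_def exp_minus field_simps)
qed

text \<open>The gap is attained on the sphere of radius \<open>e\<close>, which is compact. Convexity carries it to the
  points outside: on the segment from \<open>x\<close> to such a point, \<open>f\<close> at the crossing with the sphere is
  at most a weighted mean of the values at the two ends.\<close>

lemma convex_on_unique_minimum_gap:
  fixes f :: "'a::euclidean_space \<Rightarrow> real"
  assumes convex: "convex_on UNIV f" and cont: "continuous_on UNIV f"
    and min: "\<And>y. y \<noteq> x \<Longrightarrow> f x < f y" and "e > 0"
  shows "\<exists>m>f x. \<forall>y. e \<le> dist y x \<longrightarrow> m \<le> f y"
proof -
  have "compact (sphere x e)" "sphere x e \<noteq> {}"
    using \<open>e > 0\<close> by auto
  then obtain p where p: "p \<in> sphere x e" "\<And>q. q \<in> sphere x e \<Longrightarrow> f p \<le> f q"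
    using continuous_attains_inf continuous_on_subset[OF cont] by (metis subset_UNIV)
  show ?thesis
  proof (intro exI[of _ "f p"] conjI allI impI)
    show "f x < f p"
      using p(1) \<open>e > 0\<close> by (intro min) auto
  next
    fix y
    assume far: "e \<le> dist y x"
    define t where "t = e / dist y x"
    define q where "q = (1 - t) *\<^sub>R x + t *\<^sub>R y"
    have t: "0 \<le> t" "t \<le> 1" and t_dist: "t * dist y x = e"
      using far \<open>e > 0\<close> by (auto simp: t_def divide_simps)
    have "x - q = t *\<^sub>R (x - y)"
      by (simp add: q_def algebra_simps)
    then have "q \<in> sphere x e"
      using t t_dist by (simp add: dist_norm norm_minus_commute)
    then have "f p \<le> f q"
      by (rule p(2))
    also have "f q \<le> (1 - t) * f x + t * f y"
      unfolding q_def using t by (intro convex_onD[OF convex]) auto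
    also have "\<dots> \<le> (1 - t) * f y + t * f y"
      using min[of y] t by (cases "y = x") (auto intro!: mult_left_mono)
    also have "\<dots> = f y"
      by (simp add: algebra_simps)
    finally show "f p \<le> f y" .
  qed
qed

theorem theorem1:
  fixes H :: "real ^ ('n::finite + 'n) \<Rightarrow> real"
    and gradH :: "real ^ ('n + 'n) \<Rightarrow> real ^ ('n + 'n)"
    and zs :: "real ^ ('n + 'n)"
    and z z' :: "real \<Rightarrow> real ^ ('n + 'n)"
  assumes closed: "closed (epigraph UNIV H)"
    and convex: "convex_on UNIV H"
    and grad: "\<And>x. GDERIV H x :> gradH x"
    and C1: "continuous_on UNIV gradH"
    and unique_minimizer: "{x. is_arg_min H (\<lambda>_. True) x} = {zs}"
    and min_value: "H zs = 0" "\<And>x. H zs \<le> H x"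
    and deriv: "\<And>t. t \<ge> 0 \<Longrightarrow> (z has_vector_derivative z' t) (at t within {0..})"
    and ode: "\<And>t. t \<ge> 0 \<Longrightarrow> z' t = symplectic_J *v gradH (z t) + zs - z t"
  shows "converges_linearly_to_0 (\<lambda>t. H (z t))
    \<and> (z \<longlongrightarrow> zs) at_top
    \<and> (z' \<longlongrightarrow> 0) at_top"
proof -
  have H_deriv: "((\<lambda>t. H (z t)) has_real_derivative gradH (z t) \<bullet> z' t) (at t within {0..})"
    if "t \<ge> 0" for t
  proof -
    have "(H has_derivative (\<lambda>h. h \<bullet> gradH (z t))) (at (z t))"
      using grad by (simp add: gderiv_def)
    then have "((\<lambda>t. H (z t)) has_derivative (\<lambda>s. (s *\<^sub>R z' t) \<bullet> gradH (z t))) (at t within {0..})"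
      using deriv[OF that] unfolding has_vector_derivative_def
      by (rule has_derivative_compose[rotated])
    then show ?thesis
      by (simp add: has_field_derivative_def inner_commute mult_commute_abs)
  qed
  have dissipation: "gradH (z t) \<bullet> z' t \<le> - H (z t)" if "t \<ge> 0" for t
  proof -
    have "gradH (z t) \<bullet> z' t = gradH (z t) \<bullet> (zs - z t)"
      using inner_symplectic_J_self[of "gradH (z t)"]
      by (simp add: ode[OF that] inner_add_right inner_diff_right)
    also have "\<dots> \<le> H zs - H (z t)"
      by (rule convex_on_gradient_inequality[OF convex grad])
    finally show ?thesis
      by (simp add: min_value)
  qed
  have decay: "H (z t) \<le> H (z 0) * exp (- t)" if "t \<ge> 0" for t
    using exp_decay_if_deriv_le_neg[OF H_deriv dissipation that] .

  have H_nonneg: "0 \<le> H x" for x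
    using min_value by simp
  have linear: "converges_linearly_to_0 (\<lambda>t. H (z t))"
    unfolding converges_linearly_to_0_def
  proof (intro conjI bexI exI)
    show "\<forall>t\<ge>0. H (z t) \<le> H (z 0) * exp (- 1 * t)"
      using decay by simp
  qed (simp_all add: H_nonneg)

  have z_lim: "(z \<longlongrightarrow> zs) at_top"
  proof (rule tendstoI)
    fix e :: real
    assume "e > 0"
    have "isCont H x" for x
      using grad[of x] unfolding gderiv_def by (rule has_derivative_continuous)
    then have H_cont: "continuous_on UNIV H"
      by (simp add: continuous_at_imp_continuous_on)
    have H_strict: "H zs < H y" if "y \<noteq> zs" for y
    proof (rule ccontr)
      assume "\<not> H zs < H y"
      then have "\<not> H x < H y" for x
        using min_value(2)[of x] by linarith
      then have "y \<in> {x. is_arg_min H (\<lambda>_. True) x}"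
        by (simp add: is_arg_min_def)
      then show False
        using unique_minimizer that by simp
    qed
    obtain m where m: "H zs < m" "\<forall>y. e \<le> dist y zs \<longrightarrow> m \<le> H y"
      using convex_on_unique_minimum_gap[OF convex H_cont H_strict \<open>e > 0\<close>] by blast
    have "((\<lambda>t. exp (- t :: real)) \<longlongrightarrow> 0) at_top"
      by (rule filterlim_compose[OF exp_at_bot filterlim_uminus_at_bot_at_top])
    then have "((\<lambda>t. H (z 0) * exp (- t)) \<longlongrightarrow> H (z 0) * 0) at_top"
      by (rule tendsto_mult_left)
    then have "\<forall>\<^sub>F t in at_top. H (z 0) * exp (- t) < m"
      using m(1) min_value(1) by (intro order_tendstoD(2)) auto
    then show "\<forall>\<^sub>F t in at_top. dist (z t) zs < e"
      using eventually_ge_at_top[of 0]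
    proof eventually_elim
      case (elim t)
      then have "H (z t) < m"
        using decay[of t] by linarith
      then show ?case
        using m(2) by (meson leD leI)
    qed
  qed

  have "gradH zs = 0"
    using GDERIV_at_minimum_eq_0[OF grad min_value(2)] .
  then have "((\<lambda>t. gradH (z t)) \<longlongrightarrow> 0) at_top"
    using continuous_on_tendsto_compose[OF C1 z_lim] by simp
  then have "((\<lambda>t. symplectic_J *v gradH (z t)) \<longlongrightarrow> symplectic_J *v 0) at_top"
    by (rule bounded_linear.tendsto[OF matrix_vector_mul_bounded_linear])
  then have "((\<lambda>t. symplectic_J *v gradH (z t) + zs - z t) \<longlongrightarrow> symplectic_J *v 0 + zs - zs) at_top"
    by (intro tendsto_add tendsto_diff tendsto_const z_lim)
  moreover have "\<forall>\<^sub>F t in at_top. symplectic_J *v gradH (z t) + zs - z t = z' t"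
    using eventually_ge_at_top[of 0] by eventually_elim (simp add: ode)
  ultimately have "(z' \<longlongrightarrow> 0) at_top"
    using Lim_transform_eventually by fastforce
  with linear z_lim show ?thesis
    by blast
qed

end
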